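(* Let $G_4$ be the $4$-uniform hypergraph constructed in three stages ($\Gamma$, then $\Gamma'$, then $G_4$) in the context. Then Maker has a winning strategy for the Maker-Breaker game on $G_4$, where Maker goes first.
   Context: **Game.** The Maker-Breaker game on a finite hypergraph $G$: Maker and Breaker alternately take turns, each claiming one previously unclaimed vertex of $G$ per turn. If at any point Maker has claimed all of the vertices of some edge of $G$, Maker wins. If all of the vertices of $G$ have been claimed and Maker has not achieved this, Breaker wins. **Construction of $\Gamma$.** Write $[r]=\{1,\ldots,r\}$. The $3$-uniform hypergraph $\Gamma$ has vertex set $W \cup X \cup T$ (all listed vertices distinct, $35$ in total), where $W = \{w_i \mid i \in [5]\}$, $X = \{x_{ij} \mid i \in [5], j \in [3]\}$ and $T = \{t_{ij} \mid i \in [5], j \in [3]\}$. For $i \in [5]$ let $e_i = \{x_{i1}, x_{(i+2)2}, x_{(i+3)3}\}$, where the first indices are taken modulo $5$ in $\{1,\ldots,5\}$. The edges of $\Gamma$ are the sets $\{w_i, x_{ij}, t_{ij}\}$ for $i \in [5]$, $j \in [3]$, together with $e_1, \ldots, e_5$. **Construction of $\Gamma'$.** Starting from $\Gamma$, add new distinct vertices $y_{ijk}$ ($k \in [6]$) and $z_{ijk}$ ($k \in [4]$) for every $i \in [5]$ and $j \in [3]$. Then for every $i \in [5]$ and $j \in [3]$, writing $w = w_i$, $x = x_{ij}$, $t = t_{ij}$, $y_k = y_{ijk}$, $z_k = z_{ijk}$, replace the edge $\{w,x,t\}$ by the seven edges $$\{w,t,y_1,y_2\},\ \{x,t,y_3,y_4\},\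 \{x,t,y_5,y_6\},$$ $$\{y_1,y_3,y_5,z_1\},\ \{y_1,y_3,y_5,z_2\},\ \{y_2,y_4,y_6,z_3\},\ \{y_2,y_4,y_6,z_4\}.$$ The edges $e_1, \ldots, e_5$ are kept; they are the only edges of $\Gamma'$ of size $3$, all others having size $4$. **Construction of $G_4$.** Take the disjoint union of three copies $\Gamma'_1, \Gamma'_2, \Gamma'_3$ of $\Gamma'$, and let $e_{i1}, \ldots, e_{i5}$ be the $3$-edges of $\Gamma'_i$ (corresponding to $e_1,\ldots,e_5$) for each $i \in [3]$. Add seven extra vertices $v_1, v_2, v_3, v_4, s_1, s_2, s_3$. For each $i \in [3]$, replace $e_{i1}$ and $e_{i2}$ by $e_{i1} \cup \{v_i\}$ and $e_{i2} \cup \{v_i\}$, and replace $e_{i3}, e_{i4}, e_{i5}$ by $e_{i3} \cup \{s_i\}$, $e_{i4} \cup \{s_i\}$, $e_{i5} \cup \{s_i\}$. Finally add the edge $\{v_1, v_2, v_3, v_4\}$. *)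

theory Defs
  imports Main
begin

section \<open>The Maker-Breaker game\<close>

record 'a hypergraph =
  verts :: "'a set"
  edges :: "'a set set"

definition wf_hypergraph :: "'a hypergraph \<Rightarrow> bool" where
  "wf_hypergraph G \<longleftrightarrow> finite (verts G) \<and> (\<forall>e\<in>edges G. e \<subseteq> verts G)"

definition uniform :: "nat \<Rightarrow> 'a hypergraph \<Rightarrow> bool" where
  "uniform k G \<longleftrightarrow> (\<forall>e\<in>edges G. card e = k)"

text \<open>
  A history is the list of vertices claimed so far, oldest first.  Maker goes first, so the
  entries at positions 0, 2, 4, ... are Maker's and the others are Breaker's.
\<close>

definition maker_claimed :: "'a list \<Rightarrow> 'a set" where
  "maker_claimed h = {h ! i | i. i < length h \<and> even i}"

definition maker_won :: "'a hypergraph \<Rightarrow> 'a list \<Rightarrow> bool" where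
  "maker_won G h \<longleftrightarrow> (\<exists>e\<in>edges G. e \<subseteq> maker_claimed h)"

definition breaker_won :: "'a hypergraph \<Rightarrow> 'a list \<Rightarrow> bool" where
  "breaker_won G h \<longleftrightarrow> set h = verts G \<and> \<not> maker_won G h"

definition game_over :: "'a hypergraph \<Rightarrow> 'a list \<Rightarrow> bool" where
  "game_over G h \<longleftrightarrow> maker_won G h \<or> breaker_won G h"

definition legal_history :: "'a hypergraph \<Rightarrow> 'a list \<Rightarrow> bool" where
  "legal_history G h \<longleftrightarrow>
     distinct h \<and> set h \<subseteq> verts G \<and> (\<forall>k<length h. \<not> game_over G (take k h))"

text \<open>A strategy for Maker maps the history at each of Maker's turns to the vertex to claim.\<close>

definition follows :: "('a list \<Rightarrow> 'a) \<Rightarrow> 'a list \<Rightarrow> bool" where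
  "follows \<sigma> h \<longleftrightarrow> (\<forall>i<length h. even i \<longrightarrow> h ! i = \<sigma> (take i h))"

text \<open>
  The first conjunct makes the strategy prescribe a legal move at each of Maker's turns that can
  arise; without it a strategy making illegal moves would be winning vacuously.  On a finite
  hypergraph every play ends, so the second conjunct says that Maker wins every play.
\<close>

definition maker_winning_strategy :: "'a hypergraph \<Rightarrow> ('a list \<Rightarrow> 'a) \<Rightarrow> bool" where
  "maker_winning_strategy G \<sigma> \<longleftrightarrow>
     (\<forall>h. legal_history G h \<and> follows \<sigma> h \<and> \<not> game_over G h \<and> even (length h)
        \<longrightarrow> \<sigma> h \<in> verts G - set h) \<and>
     (\<forall>h. legal_history G h \<and> follows \<sigma> h \<and> game_over G h \<longrightarrow> maker_won G h)"


section \<open>The hypergraph \<open>\<Gamma>\<close>\<close>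

datatype gamma_vertex = W nat | X nat nat | T nat nat

definition mod5 :: "nat \<Rightarrow> nat" where
  "mod5 n = (if n mod 5 = 0 then 5 else n mod 5)"

definition core_edge :: "nat \<Rightarrow> gamma_vertex set" where
  "core_edge i = {X i 1, X (mod5 (i + 2)) 2, X (mod5 (i + 3)) 3}"

definition spoke :: "nat \<Rightarrow> nat \<Rightarrow> gamma_vertex set" where
  "spoke i j = {W i, X i j, T i j}"

definition Gamma :: "gamma_vertex hypergraph" where
  "Gamma = \<lparr>
     verts = {W i | i. i \<in> {1..5}}
           \<union> {X i j | i j. i \<in> {1..5} \<and> j \<in> {1..3}}
           \<union> {T i j | i j. i \<in> {1..5} \<and> j \<in> {1..3}},
     edges = {spoke i j | i j. i \<in> {1..5} \<and> j \<in> {1..3}}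
           \<union> {core_edge i | i. i \<in> {1..5}} \<rparr>"


section \<open>The hypergraph \<open>\<Gamma>'\<close>\<close>

datatype gamma'_vertex = Old gamma_vertex | Y nat nat nat | Z nat nat nat

definition gadget :: "nat \<Rightarrow> nat \<Rightarrow> gamma'_vertex set set" where
  "gadget i j = (let w = Old (W i); x = Old (X i j); t = Old (T i j); y = Y i j; z = Z i j in
     {{w, t, y 1, y 2}, {x, t, y 3, y 4}, {x, t, y 5, y 6},
      {y 1, y 3, y 5, z 1}, {y 1, y 3, y 5, z 2},
      {y 2, y 4, y 6, z 3}, {y 2, y 4, y 6, z 4}})"

definition Gamma' :: "gamma'_vertex hypergraph" where
  "Gamma' = \<lparr>
     verts = Old ` verts Gamma
           \<union> {Y i j k | i j k. i \<in> {1..5} \<and> j \<in> {1..3} \<and> k \<in> {1..6}}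
           \<union> {Z i j k | i j k. i \<in> {1..5} \<and> j \<in> {1..3} \<and> k \<in> {1..4}},
     edges = (image Old) ` (edges Gamma - {spoke i j | i j. i \<in> {1..5} \<and> j \<in> {1..3}})
           \<union> (\<Union>i\<in>{1..5}. \<Union>j\<in>{1..3}. gadget i j) \<rparr>"

definition core_edge' :: "nat \<Rightarrow> gamma'_vertex set" where
  "core_edge' i = Old ` core_edge i"


section \<open>The hypergraph \<open>G\<^sub>4\<close>\<close>

text \<open>\<open>Copy i u\<close> is the vertex \<open>u\<close> in the \<open>i\<close>-th copy of \<open>\<Gamma>'\<close>.\<close>

datatype g4_vertex = Copy nat gamma'_vertex | V nat | S nat

definition G4 :: "g4_vertex hypergraph" where
  "G4 = \<lparr>
     verts = (\<Union>i\<in>{1..3}. Copy i ` verts Gamma') \<union> {V 1, V 2, V 3, V 4} \<union> {S 1, S 2, S 3},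
     edges = (\<Union>i\<in>{1..3}. (image (Copy i)) ` (edges Gamma' - {core_edge' k | k. k \<in> {1..5}}))
           \<union> {insert (V i) (Copy i ` core_edge' k) | i k. i \<in> {1..3} \<and> k \<in> {1, 2}}
           \<union> {insert (S i) (Copy i ` core_edge' k) | i k. i \<in> {1..3} \<and> k \<in> {3, 4, 5}}
           \<union> {{V 1, V 2, V 3, V 4}} \<rparr>"


section \<open>Sanity checks\<close>

lemma core_edge_ne_spoke: "core_edge k \<noteq> spoke i j"
  by (auto simp: core_edge_def spoke_def)

lemma edges_Gamma':
  "edges Gamma' = {core_edge' i | i. i \<in> {1..5}} \<union> (\<Union>i\<in>{1..5}. \<Union>j\<in>{1..3}. gadget i j)"
proof -
  have "edges Gamma - {spoke i j | i j. i \<in> {1..5} \<and> j \<in> {1..3}} = core_edge ` {1..5}"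
    using core_edge_ne_spoke by (auto simp: Gamma_def)
  then show ?thesis
    unfolding Gamma'_def core_edge'_def by auto
qed

lemma mod5_range: "mod5 n \<in> {1..5}"
proof -
  have "n mod 5 < 5" by simp
  then show ?thesis unfolding mod5_def by auto
qed

lemma verts_Gamma_eq:
  "verts Gamma = W ` {1..5} \<union> (\<lambda>(i, j). X i j) ` ({1..5} \<times> {1..3})
     \<union> (\<lambda>(i, j). T i j) ` ({1..5} \<times> {1..3})"
  unfolding Gamma_def by auto

lemma verts_Gamma'_eq:
  "verts Gamma' = Old ` verts Gamma
     \<union> (\<lambda>(i, j, k). Y i j k) ` ({1..5} \<times> {1..3} \<times> {1..6})
     \<union> (\<lambda>(i, j, k). Z i j k) ` ({1..5} \<times> {1..3} \<times> {1..4})"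
  unfolding Gamma'_def by (auto simp: image_iff)

lemma card_verts_Gamma: "finite (verts Gamma)" "card (verts Gamma) = 35"
proof -
  show "finite (verts Gamma)" unfolding verts_Gamma_eq by auto
  have "card (W ` {1..5}) = 5" by (simp add: card_image inj_on_def)
  moreover have "card ((\<lambda>(i, j). X i j) ` ({1..5} \<times> {1..3})) = 15"
    "card ((\<lambda>(i, j). T i j) ` ({1..5} \<times> {1..3})) = 15"
    by (subst card_image; auto simp: inj_on_def)+
  ultimately show "card (verts Gamma) = 35"
    unfolding verts_Gamma_eq by (subst card_Un_disjoint; (subst card_Un_disjoint)?; auto)
qed

lemma wf_Gamma: "wf_hypergraph Gamma"
proof -
  have core: "core_edge i \<subseteq> verts Gamma" if "i \<in> {1..5}" for i
    using that mod5_range[of "i + 2"] mod5_range[of "i + 3"]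
    by (auto simp: core_edge_def Gamma_def)
  have spoke: "spoke i j \<subseteq> verts Gamma" if "i \<in> {1..5}" "j \<in> {1..3}" for i j
    using that by (auto simp: spoke_def Gamma_def)
  have "e \<subseteq> verts Gamma" if "e \<in> edges Gamma" for e
  proof -
    from that consider i j where "i \<in> {1..5}" "j \<in> {1..3}" "e = spoke i j"
      | i where "i \<in> {1..5}" "e = core_edge i"
      unfolding Gamma_def hypergraph.select_convs by (elim UnE CollectE exE conjE)
    then show ?thesis
      by cases (simp_all only: core spoke)
  qed
  then show ?thesis
    unfolding wf_hypergraph_def using card_verts_Gamma(1) by simp
qed

lemma uniform_Gamma: "uniform 3 Gamma"
  unfolding uniform_def Gamma_def by (auto simp: spoke_def core_edge_def)

lemma card_gadget_edge: "e \<in> gadget i j \<Longrightarrow> card e = 4"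
  unfolding gadget_def Let_def by auto

lemma card_core_edge': "card (core_edge' i) = 3"
  unfolding core_edge'_def core_edge_def by auto

lemma three_edges_Gamma':
  "{e \<in> edges Gamma'. card e = 3} = {core_edge' i | i. i \<in> {1..5}}"
proof -
  have "card e \<noteq> 3" if "e \<in> gadget i j" for e i j
    using card_gadget_edge[OF that] by simp
  then show ?thesis
    unfolding edges_Gamma' using card_core_edge' by fastforce
qed

lemma wf_Gamma': "wf_hypergraph Gamma'"
proof -
  have "finite (verts Gamma')"
    unfolding verts_Gamma'_eq using card_verts_Gamma(1) by auto
  moreover have "core_edge' i \<subseteq> verts Gamma'" if "i \<in> {1..5}" for i
  proof -
    have "core_edge i \<in> edges Gamma" using that by (auto simp: Gamma_def)
    then have "core_edge i \<subseteq> verts Gamma" using wf_Gamma by (auto simp: wf_hypergraph_def)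
    then show ?thesis unfolding core_edge'_def verts_Gamma'_eq by auto
  qed
  moreover have "e \<subseteq> verts Gamma'" if "i \<in> {1..5}" "j \<in> {1..3}" "e \<in> gadget i j" for i j e
  proof -
    have "Old (W i) \<in> verts Gamma'" "Old (X i j) \<in> verts Gamma'" "Old (T i j) \<in> verts Gamma'"
      using that(1,2) by (simp_all add: Gamma'_def Gamma_def image_iff)
    moreover have "Y i j k \<in> verts Gamma'" if "k \<in> {1..6}" for k
      using \<open>i \<in> {1..5}\<close> \<open>j \<in> {1..3}\<close> that by (simp add: Gamma'_def)
    moreover have "Z i j k \<in> verts Gamma'" if "k \<in> {1..4}" for k
      using \<open>i \<in> {1..5}\<close> \<open>j \<in> {1..3}\<close> that by (simp add: Gamma'_def)
    ultimately have "\<forall>f \<in> gadget i j. f \<subseteq> verts Gamma'"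
      by (simp add: gadget_def Let_def)
    then show ?thesis using that(3) by blast
  qed
  ultimately show ?thesis
    unfolding wf_hypergraph_def edges_Gamma' by blast
qed

lemma non_core_edges_Gamma':
  "edges Gamma' - {core_edge' k | k. k \<in> {1..5}} = (\<Union>i\<in>{1..5}. \<Union>j\<in>{1..3}. gadget i j)"
proof -
  have "core_edge' k \<notin> gadget i j" for i j k
    using card_gadget_edge[of "core_edge' k" i j] card_core_edge'[of k] by auto
  then show ?thesis unfolding edges_Gamma' by blast
qed

lemma G4_edge_cases:
  assumes "e \<in> edges G4"
  obtains (gadget) i a b f where "i \<in> {1..3}" "a \<in> {1..5}" "b \<in> {1..3}" "f \<in> gadget a b"
      "e = Copy i ` f"
    | (v) i k where "i \<in> {1..3}" "k \<in> {1, 2}" "e = insert (V i) (Copy i ` core_edge' k)"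
    | (s) i k where "i \<in> {1..3}" "k \<in> {3, 4, 5}" "e = insert (S i) (Copy i ` core_edge' k)"
    | (extra) "e = {V 1, V 2, V 3, V 4}"
  using assms unfolding G4_def hypergraph.select_convs non_core_edges_Gamma'
proof (elim UnE)
  assume "e \<in> (\<Union>i\<in>{1..3}. image (Copy i) ` (\<Union>i\<in>{1..5}. \<Union>j\<in>{1..3}. gadget i j))"
  then show thesis by (elim UN_E imageE) (rule gadget)
next
  assume "e \<in> {insert (V i) (Copy i ` core_edge' k) | i k. i \<in> {1..3} \<and> k \<in> {1, 2}}"
  then show thesis by (elim CollectE exE conjE) (rule v)
next
  assume "e \<in> {insert (S i) (Copy i ` core_edge' k) | i k. i \<in> {1..3} \<and> k \<in> {3, 4, 5}}"
  then show thesis by (elim CollectE exE conjE) (rule s)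
next
  assume "e \<in> {{V 1, V 2, V 3, V 4}}"
  then show thesis by (intro extra) simp
qed

lemma wf_G4: "wf_hypergraph G4"
proof -
  have *: "finite (verts Gamma')" "\<And>e. e \<in> edges Gamma' \<Longrightarrow> e \<subseteq> verts Gamma'"
    using wf_Gamma' by (auto simp: wf_hypergraph_def)
  have copy: "Copy i ` f \<subseteq> verts G4" if "i \<in> {1..3}" "f \<in> edges Gamma'" for i f
  proof -
    have "Copy i ` verts Gamma' \<subseteq> verts G4"
      unfolding G4_def hypergraph.select_convs using that(1) by blast
    then show ?thesis using *(2)[OF that(2)] by blast
  qed
  have gadget_edge: "f \<in> edges Gamma'" if "a \<in> {1..5}" "b \<in> {1..3}" "f \<in> gadget a b" for a b f
    using that unfolding edges_Gamma' by blast
  have core: "core_edge' k \<in> edges Gamma'" if "k \<in> {1, 2, 3, 4, 5}" for k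
  proof -
    have "k \<in> {1..5}" using that by auto
    then show ?thesis unfolding edges_Gamma' by blast
  qed
  have VS: "V i \<in> verts G4" "S i \<in> verts G4" if "i \<in> {1..3}" for i
  proof -
    have "i = 1 \<or> i = 2 \<or> i = 3" using that by auto
    then show "V i \<in> verts G4" "S i \<in> verts G4"
      unfolding G4_def hypergraph.select_convs by blast+
  qed
  have "finite (verts G4)"
    unfolding G4_def using *(1) by simp
  moreover have "e \<subseteq> verts G4" if "e \<in> edges G4" for e
    using that
  proof (cases rule: G4_edge_cases)
    case (gadget i a b f)
    then show ?thesis using copy gadget_edge by blast
  next
    case (v i k)
    then show ?thesis using copy[of i "core_edge' k"] core[of k] VS[of i] by blast
  next
    case (s i k)
    then show ?thesis using copy[of i "core_edge' k"] core[of k] VS[of i] by blast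
  next
    case extra
    then show ?thesis unfolding G4_def by simp
  qed
  ultimately show ?thesis unfolding wf_hypergraph_def by blast
qed

lemma uniform_G4: "uniform 4 G4"
proof -
  have "card (Copy i ` core_edge' k) = 3" for i k
    by (subst card_image) (simp_all add: inj_on_def card_core_edge')
  moreover have "finite (Copy i ` core_edge' k)" for i k
    by (simp add: core_edge'_def core_edge_def)
  moreover have "V i \<notin> Copy i ` core_edge' k" "S i \<notin> Copy i ` core_edge' k" for i k
    by auto
  ultimately have core: "card (insert (V i) (Copy i ` core_edge' k)) = 4"
    "card (insert (S i) (Copy i ` core_edge' k)) = 4" for i k
    by simp_all
  have "card e = 4" if "e \<in> edges G4" for e
    using that
  proof (cases rule: G4_edge_cases)
    case (gadget i a b f)
    then show ?thesis by (simp add: card_image inj_on_def card_gadget_edge[OF gadget(4)])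
  next
    case (v i k)
    then show ?thesis by (simp only: core)
  next
    case (s i k)
    then show ?thesis by (simp only: core)
  next
    case extra
    then show ?thesis by simp
  qed
  then show ?thesis unfolding uniform_def by blast
qed

end

theory Submission
  imports Defs
begin

text \<open>
  Once Maker owns \<open>w\<close> and \<open>x\<close> of an untouched gadget, taking \<open>t\<close> wins even if Breaker moves next,
  so a gadget plays the role of the edge \<open>{w, x, t}\<close>.  Hence two groups \<open>w\<close> lying on an
  untouched core edge \<open>{x, x', x''}\<close> win with Maker to move: \<open>x\<close> has to be answered in its
  gadget, and then \<open>x'\<close> threatens both \<open>x''\<close> and its own gadget.  Core edge \<open>k\<close> meets the groups
  \<open>k\<close>, \<open>k + 2\<close>, \<open>k + 3\<close> modulo 5, so two groups at distance 2 share two core edges, a double threat.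
  With this Maker wins a copy in which he owns \<open>V\<close> and \<open>S\<close>, even when Breaker moves first there.

  In \<open>G4\<close> Maker claims \<open>V 1\<close>, \<open>V 2\<close>, \<open>V 3\<close>.  If Breaker does not answer in the copy of the current
  \<open>V i\<close> (including \<open>S i\<close>), Maker takes \<open>S i\<close>; otherwise \<open>V 3\<close> forces Breaker to take \<open>V 4\<close>, and Maker
  takes \<open>S 3\<close>.
\<close>

section \<open>Winning positions\<close>

inductive maker_wins :: "'a hypergraph \<Rightarrow> 'a set \<Rightarrow> 'a set \<Rightarrow> bool" for G where
  finished: "e \<in> edges G \<Longrightarrow> e \<subseteq> M \<Longrightarrow> maker_wins G M B"
| move: "v \<notin> B \<Longrightarrow> (\<And>u. maker_wins G (insert v M) (insert u B)) \<Longrightarrow> maker_wins G M B"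

text \<open>
  Neither player is bound by the rules here: Maker may waste a move on a vertex that he already
  owns or that does not exist, and Breaker may name any vertex at all.  This makes the predicate
  monotone in both arguments, and \<open>maker_wins_legal_move\<close> recovers a legal winning move.
\<close>

lemma maker_wins_mono:
  assumes "maker_wins G M B" "wf_hypergraph G" "M \<inter> verts G \<subseteq> M'" "B' \<subseteq> B"
  shows "maker_wins G M' B'"
  using assms
proof (induction arbitrary: M' B')
  case (finished e M B)
  then have "e \<subseteq> M'" unfolding wf_hypergraph_def by blast
  with finished.hyps(1) show ?case by (rule maker_wins.finished)
next
  case (move v B M)
  show ?case
  proof (rule maker_wins.move)
    show "v \<notin> B'" using move.hyps move.prems by blast
    show "maker_wins G (insert v M') (insert u B')" for u
      by (rule move.IH) (use move.prems in auto)
  qed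
qed

text \<open>A move off the board or onto one of Maker's own vertices adds nothing to
  \<open>M'\<close>, so the induction skips it; both inclusions survive the skip. As
  \<open>M'\<close> contains no edge, a legal move must come up.\<close>

lemma maker_wins_legal_move:
  assumes "maker_wins G M B" "wf_hypergraph G" "\<forall>e\<in>edges G. \<not> e \<subseteq> M'"
    "M \<inter> verts G \<subseteq> M'" "B' \<subseteq> B"
  shows "\<exists>v\<in>verts G - (M' \<union> B'). \<forall>u. maker_wins G (insert v M') (insert u B')"
  using assms
proof (induction arbitrary: M' B')
  case (finished e M B)
  then have "e \<subseteq> M'" unfolding wf_hypergraph_def by blast
  with finished.hyps(1) finished.prems(2) show ?case by blast
next
  case (move v B M)
  show ?case
  proof (cases "v \<in> verts G - M'")
    case True
    have "maker_wins G (insert v M') (insert u B')" for u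
      by (rule maker_wins_mono[OF move.hyps(2)[of u] move.prems(1)]) (use move.prems(3,4) in auto)
    moreover have "v \<in> verts G - (M' \<union> B')"
      using True move.hyps(1) move.prems(4) by blast
    ultimately show ?thesis by blast
  next
    case False
    \<comment> \<open>Breaker's reply to the skipped move is taken to be \<open>v\<close>; any reply
      would do, since it only enlarges \<open>B\<close>.\<close>
    then have "insert v M \<inter> verts G \<subseteq> M'" "B' \<subseteq> insert v B"
      using move.prems(3,4) by blast+
    then show ?thesis
      by (rule move.IH[OF move.prems(1,2)])
  qed
qed

section \<open>Histories, and from winning positions to a strategy\<close>

lemma maker_claimed_Nil [simp]: "maker_claimed [] = {}"
  by (simp add: maker_claimed_def)

lemma maker_claimed_snoc:
  fixes h :: "'a list"
  shows "maker_claimed (h @ [a]) = (if even (length h) then insert a (maker_claimed h) else maker_claimed h)"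
proof -
  have claimed: "maker_claimed g = (!) g ` {i. i < length g \<and> even i}" for g :: "'a list"
    unfolding maker_claimed_def by blast
  have "{i. i < length (h @ [a]) \<and> even i} =
      (if even (length h) then insert (length h) {i. i < length h \<and> even i}
       else {i. i < length h \<and> even i})"
    by (auto simp: less_Suc_eq)
  moreover have "(!) (h @ [a]) ` {i. i < length h \<and> even i} = (!) h ` {i. i < length h \<and> even i}"
    by (rule image_cong) (simp_all add: nth_append)
  ultimately show ?thesis by (simp add: claimed)
qed

lemma maker_claimed_subset: "maker_claimed h \<subseteq> set h"
  by (auto simp: maker_claimed_def)

lemma legal_history_snocD:
  assumes "legal_history G (h @ [a])"
  shows "legal_history G h" "\<not> game_over G h" "a \<notin> set h"
proof -
  have *: "\<not> game_over G (take k (h @ [a]))" if "k \<le> length h" for k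
    using assms that by (auto simp: legal_history_def)
  show "\<not> game_over G h" using *[of "length h"] by simp
  have "\<not> game_over G (take k h)" if "k < length h" for k
    using *[of k] that by simp
  then show "legal_history G h"
    using assms by (simp add: legal_history_def)
  show "a \<notin> set h" using assms by (simp add: legal_history_def)
qed

lemma follows_snocD:
  assumes "follows \<sigma> (h @ [a])"
  shows "follows \<sigma> h" "even (length h) \<Longrightarrow> a = \<sigma> h"
proof -
  have *: "(h @ [a]) ! i = \<sigma> (take i (h @ [a]))" if "i \<le> length h" "even i" for i
    using assms that by (auto simp: follows_def)
  show "a = \<sigma> h" if "even (length h)"
    using *[of "length h"] that by simp
  have "h ! i = \<sigma> (take i h)" if "i < length h" "even i" for i
    using *[of i] that by (simp add: nth_append)
  then show "follows \<sigma> h" by (simp add: follows_def)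
qed

text \<open>The strategy picks any legal move that keeps the position winning, so the win persists
  along every play. On a full board without an edge of Maker such a move would still have to
  exist.\<close>

theorem maker_wins_imp_strategy:
  assumes wf: "wf_hypergraph G" and win: "maker_wins G {} {}"
  shows "\<exists>\<sigma>. maker_winning_strategy G \<sigma>"
proof -
  define good where "good h v \<longleftrightarrow> v \<in> verts G - set h \<and>
    (\<forall>u. maker_wins G (insert v (maker_claimed h)) (insert u (set h - maker_claimed h)))" for h v
  define \<sigma> where "\<sigma> h = (SOME v. good h v)" for h
  have exists: "\<exists>v. good h v"
    if "maker_wins G (maker_claimed h) (set h - maker_claimed h)" "\<not> maker_won G h" for h
    using maker_wins_legal_move[OF that(1) wf, of "maker_claimed h" "set h - maker_claimed h"]
      that(2) maker_claimed_subset[of h]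
    by (auto simp: maker_won_def good_def)
  have good: "good h (\<sigma> h)"
    if "maker_wins G (maker_claimed h) (set h - maker_claimed h)" "\<not> maker_won G h" for h
    unfolding \<sigma>_def using exists[OF that] by (rule someI_ex)
  \<comment> \<open>At odd length Breaker is to move, whereas \<open>maker_wins\<close> has Maker to
    move; hence the quantifier over the reply \<open>u\<close>.\<close>
  have inv: "if even (length h) then maker_wins G (maker_claimed h) (set h - maker_claimed h)
      else \<forall>u. maker_wins G (maker_claimed h) (insert u (set h - maker_claimed h))"
    if "legal_history G h" "follows \<sigma> h" for h
    using that
  proof (induction h rule: rev_induct)
    case Nil
    then show ?case using win by simp
  next
    case (snoc a h)
    note legal = legal_history_snocD[OF snoc.prems(1)]
    note fol = follows_snocD[OF snoc.prems(2)]
    have a: "a \<notin> maker_claimed h" using legal(3) maker_claimed_subset[of h] by blast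
    show ?case
    proof (cases "even (length h)")
      case True
      then have "good h a"
        using good[of h] snoc.IH[OF legal(1) fol(1)] legal(2) fol(2) by (simp add: game_over_def)
      moreover have "set (h @ [a]) - insert a (maker_claimed h) = set h - maker_claimed h"
        using legal(3) by auto
      ultimately show ?thesis
        using True by (simp add: good_def maker_claimed_snoc)
    next
      case False
      moreover have "set (h @ [a]) - maker_claimed h = insert a (set h - maker_claimed h)"
        using a by auto
      ultimately show ?thesis
        using snoc.IH[OF legal(1) fol(1)] by (simp add: maker_claimed_snoc)
    qed
  qed
  have inv': "maker_wins G (maker_claimed h) (set h - maker_claimed h)"
    if "legal_history G h" "follows \<sigma> h" for h
  proof (cases "even (length h)")
    case True
    then show ?thesis using inv[OF that] by simp
  next
    case False
    \<comment> \<open>\<open>undefined\<close> is an arbitrary reply, removed again by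
      monotonicity.\<close>
    then have "maker_wins G (maker_claimed h) (insert undefined (set h - maker_claimed h))"
      using inv[OF that] by simp
    from this wf show ?thesis by (rule maker_wins_mono) auto
  qed
  have "\<sigma> h \<in> verts G - set h"
    if "legal_history G h" "follows \<sigma> h" "\<not> game_over G h" for h
    using good[OF inv'[OF that(1,2)]] that(3) by (simp add: game_over_def good_def)
  moreover have "maker_won G h"
    if "legal_history G h" "follows \<sigma> h" "game_over G h" for h
  proof (rule ccontr)
    assume *: "\<not> maker_won G h"
    then have "set h = verts G"
      using that(3) by (simp add: game_over_def breaker_won_def)
    then show False
      using good[OF inv'[OF that(1,2)] *] by (simp add: good_def)
  qed
  ultimately show ?thesis unfolding maker_winning_strategy_def by blast
qed

section \<open>Threats\<close>

lemma maker_wins_threat: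
  assumes "e \<in> edges G" "e \<subseteq> insert a M" "a \<notin> B"
  shows "maker_wins G M B"
  by (rule maker_wins.move[OF assms(3)], rule maker_wins.finished[OF assms(1,2)])

text \<open>Any reply but \<open>a\<close> lets Maker complete \<open>e\<close> at
  \<open>a\<close>.\<close>

lemma maker_wins_force:
  assumes "v \<notin> B" "e \<in> edges G" "e \<subseteq> insert a (insert v M)" "a \<notin> B"
    and "maker_wins G (insert v M) (insert a B)"
  shows "maker_wins G M B"
proof (rule maker_wins.move[OF assms(1)])
  fix u
  show "maker_wins G (insert v M) (insert u B)"
  proof (cases "u = a")
    case False
    then show ?thesis using assms by (intro maker_wins_threat[of e _ a]) auto
  qed (use assms in simp)
qed

lemma maker_wins_double_threat:
  assumes "v \<notin> B" "e \<in> edges G" "e \<subseteq> insert a (insert v M)" "a \<notin> B"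
    and "f \<in> edges G" "f \<subseteq> insert b (insert v M)" "b \<notin> B" "a \<noteq> b"
  shows "maker_wins G M B"
proof (rule maker_wins_force[OF assms(1-4)])
  show "maker_wins G (insert v M) (insert a B)"
    using assms(7,8) by (intro maker_wins_threat[OF assms(5,6)]) simp
qed

text \<open>The moves \<open>a\<^sub>1\<close> and \<open>a\<^sub>2\<close> force the replies
  \<open>b\<^sub>1\<close> and \<open>b\<^sub>2\<close>; then \<open>a\<^sub>3\<close> threatens
  \<open>f\<close> at \<open>c\<close> and \<open>g\<close> at \<open>d\<close>. This is the play on
  one side of a gadget.\<close>

lemma maker_wins_forced_pairs:
  assumes E: "e\<^sub>1 \<in> edges G" "e\<^sub>2 \<in> edges G" "f \<in> edges G" "g \<in> edges G"
    and sub: "e\<^sub>1 \<subseteq> M \<union> {a\<^sub>1, b\<^sub>1}" "e\<^sub>2 \<subseteq> M \<union> {a\<^sub>2, b\<^sub>2}"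
      "f \<subseteq> M \<union> {a\<^sub>1, a\<^sub>2, a\<^sub>3, c}" "g \<subseteq> M \<union> {a\<^sub>1, a\<^sub>2, a\<^sub>3, d}"
    and free: "{a\<^sub>1, b\<^sub>1, a\<^sub>2, b\<^sub>2, a\<^sub>3, c, d} \<inter> B = {}" "distinct [a\<^sub>1, b\<^sub>1, a\<^sub>2, b\<^sub>2, a\<^sub>3, c, d]"
  shows "maker_wins G M B"
proof (rule maker_wins_force[OF _ E(1)])
  show "a\<^sub>1 \<notin> B" "b\<^sub>1 \<notin> B" using free by auto
  show "e\<^sub>1 \<subseteq> insert b\<^sub>1 (insert a\<^sub>1 M)" using sub(1) by blast
  show "maker_wins G (insert a\<^sub>1 M) (insert b\<^sub>1 B)"
  proof (rule maker_wins_force[OF _ E(2)])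
    show "a\<^sub>2 \<notin> insert b\<^sub>1 B" "b\<^sub>2 \<notin> insert b\<^sub>1 B" using free by auto
    show "e\<^sub>2 \<subseteq> insert b\<^sub>2 (insert a\<^sub>2 (insert a\<^sub>1 M))" using sub(2) by blast
    show "maker_wins G (insert a\<^sub>2 (insert a\<^sub>1 M)) (insert b\<^sub>2 (insert b\<^sub>1 B))"
    proof (rule maker_wins_double_threat[OF _ E(3) _ _ E(4)])
      show "f \<subseteq> insert c (insert a\<^sub>3 (insert a\<^sub>2 (insert a\<^sub>1 M)))" using sub(3) by blast
      show "g \<subseteq> insert d (insert a\<^sub>3 (insert a\<^sub>2 (insert a\<^sub>1 M)))" using sub(4) by blast
    qed (use free in auto)
  qed
qed

section \<open>Gadgets and core edges\<close>

abbreviation w :: "nat \<Rightarrow> nat \<Rightarrow> g4_vertex" where "w c i \<equiv> Copy c (Old (W i))"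
abbreviation x :: "nat \<Rightarrow> nat \<Rightarrow> nat \<Rightarrow> g4_vertex" where "x c i j \<equiv> Copy c (Old (X i j))"
abbreviation t :: "nat \<Rightarrow> nat \<Rightarrow> nat \<Rightarrow> g4_vertex" where "t c i j \<equiv> Copy c (Old (T i j))"
abbreviation y :: "nat \<Rightarrow> nat \<Rightarrow> nat \<Rightarrow> nat \<Rightarrow> g4_vertex" where "y c i j k \<equiv> Copy c (Y i j k)"
abbreviation z :: "nat \<Rightarrow> nat \<Rightarrow> nat \<Rightarrow> nat \<Rightarrow> g4_vertex" where "z c i j k \<equiv> Copy c (Z i j k)"

text \<open>All indices are allowed, so that no bounds have to be carried along; the additional
  vertices are off the board.\<close>

definition yz :: "nat \<Rightarrow> nat \<Rightarrow> nat \<Rightarrow> g4_vertex set" where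
  "yz c i j = range (y c i j) \<union> range (z c i j)"

lemma gadget_edge_G4:
  assumes "c \<in> {1..3}" "i \<in> {1..5}" "j \<in> {1..3}" "f \<in> gadget i j"
  shows "Copy c ` f \<in> edges G4"
proof -
  have "f \<in> (\<Union>i\<in>{1..5}. \<Union>j\<in>{1..3}. gadget i j)" using assms by blast
  then show ?thesis
    unfolding G4_def hypergraph.select_convs non_core_edges_Gamma' using assms(1) by blast
qed

lemma gadget_edges_G4:
  assumes "c \<in> {1..3}" "i \<in> {1..5}" "j \<in> {1..3}"
  shows "{w c i, t c i j, y c i j 1, y c i j 2} \<in> edges G4"
    "{x c i j, t c i j, y c i j 3, y c i j 4} \<in> edges G4"
    "{x c i j, t c i j, y c i j 5, y c i j 6} \<in> edges G4"
    "{y c i j 1, y c i j 3, y c i j 5, z c i j 1} \<in> edges G4"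
    "{y c i j 1, y c i j 3, y c i j 5, z c i j 2} \<in> edges G4"
    "{y c i j 2, y c i j 4, y c i j 6, z c i j 3} \<in> edges G4"
    "{y c i j 2, y c i j 4, y c i j 6, z c i j 4} \<in> edges G4"
proof -
  have "\<forall>f\<in>gadget i j. Copy c ` f \<in> edges G4"
    using gadget_edge_G4[OF assms] by blast
  then show "{w c i, t c i j, y c i j 1, y c i j 2} \<in> edges G4"
    "{x c i j, t c i j, y c i j 3, y c i j 4} \<in> edges G4"
    "{x c i j, t c i j, y c i j 5, y c i j 6} \<in> edges G4"
    "{y c i j 1, y c i j 3, y c i j 5, z c i j 1} \<in> edges G4"
    "{y c i j 1, y c i j 3, y c i j 5, z c i j 2} \<in> edges G4"
    "{y c i j 2, y c i j 4, y c i j 6, z c i j 3} \<in> edges G4"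
    "{y c i j 2, y c i j 4, y c i j 6, z c i j 4} \<in> edges G4"
    by (simp_all add: gadget_def Let_def)
qed

text \<open>
  Maker goes for the odd or the even \<open>y\<close>-vertices, whichever side (with its \<open>z\<close>-vertices) avoids
  Breaker's \<open>u\<close>; the pair of \<open>y\<close>-vertices that \<open>u\<close> may have spoilt comes last, where Maker
  needs no forcing.
\<close>

lemma gadget_win:
  assumes ind: "c \<in> {1..3}" "i \<in> {1..5}" "j \<in> {1..3}"
    and M: "w c i \<in> M" "x c i j \<in> M" "t c i j \<in> M" and B: "yz c i j \<inter> B = {}"
  shows "maker_wins G4 M (insert u B)"
proof -
  note E = gadget_edges_G4[OF ind]
  have free [simp]: "y c i j k \<notin> B" "z c i j k \<notin> B" for k
    using B by (auto simp: yz_def)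
  consider (odd) "u \<notin> {y c i j 1, y c i j 3, y c i j 5, z c i j 1, z c i j 2}"
    | (even) "u \<notin> {y c i j 2, y c i j 4, y c i j 6, z c i j 3, z c i j 4}"
    by (cases "u \<in> {y c i j 1, y c i j 3, y c i j 5, z c i j 1, z c i j 2}") auto
  then show ?thesis
  proof cases
    case odd
    consider "u = y c i j 2" | "u = y c i j 4" | "u \<notin> {y c i j 2, y c i j 4}" by blast
    then show ?thesis
    proof cases
      case 1
      show ?thesis
        by (rule maker_wins_forced_pairs[OF E(2,3,4,5),
              of _ "y c i j 3" "y c i j 4" "y c i j 5" "y c i j 6" "y c i j 1" "z c i j 1" "z c i j 2"])
          (use M odd 1 in simp_all)
    next
      case 2
      show ?thesis
        by (rule maker_wins_forced_pairs[OF E(1,3,4,5),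
              of _ "y c i j 1" "y c i j 2" "y c i j 5" "y c i j 6" "y c i j 3" "z c i j 1" "z c i j 2"])
          (use M odd 2 in simp_all)
    next
      case 3
      show ?thesis
        by (rule maker_wins_forced_pairs[OF E(1,2,4,5),
              of _ "y c i j 1" "y c i j 2" "y c i j 3" "y c i j 4" "y c i j 5" "z c i j 1" "z c i j 2"])
          (use M odd 3 in simp_all)
    qed
  next
    case even
    consider "u = y c i j 1" | "u = y c i j 3" | "u \<notin> {y c i j 1, y c i j 3}" by blast
    then show ?thesis
    proof cases
      case 1
      show ?thesis
        by (rule maker_wins_forced_pairs[OF E(2,3,6,7),
              of _ "y c i j 4" "y c i j 3" "y c i j 6" "y c i j 5" "y c i j 2" "z c i j 3" "z c i j 4"])
          (use M even 1 in simp_all)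
    next
      case 2
      show ?thesis
        by (rule maker_wins_forced_pairs[OF E(1,3,6,7),
              of _ "y c i j 2" "y c i j 1" "y c i j 6" "y c i j 5" "y c i j 4" "z c i j 3" "z c i j 4"])
          (use M even 2 in simp_all)
    next
      case 3
      show ?thesis
        by (rule maker_wins_forced_pairs[OF E(1,2,6,7),
              of _ "y c i j 2" "y c i j 1" "y c i j 4" "y c i j 3" "y c i j 6" "z c i j 3" "z c i j 4"])
          (use M even 3 in simp_all)
    qed
  qed
qed

lemma spoke_win:
  assumes "c \<in> {1..3}" "i \<in> {1..5}" "j \<in> {1..3}" "w c i \<in> M" "x c i j \<in> M"
    and "insert (t c i j) (yz c i j) \<inter> B = {}"
  shows "maker_wins G4 M B"
proof (rule maker_wins.move[of "t c i j"])
  show "maker_wins G4 (insert (t c i j) M) (insert u B)" for u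
    using assms(4-6) by (intro gadget_win[OF assms(1-3)]) simp_all
qed (use assms(6) in simp)

text \<open>\<open>w c i\<close> is left out because the gadgets of its group share it; thus
  different zones of a copy are disjoint.\<close>

definition zone :: "nat \<Rightarrow> nat \<Rightarrow> nat \<Rightarrow> g4_vertex set" where
  "zone c i j = insert (x c i j) (insert (t c i j) (yz c i j))"

text \<open>
  Taking \<open>x c i j\<close> threatens \<open>spoke_win\<close>, so Breaker must answer in that zone; taking
  \<open>x c i' j'\<close> then threatens both the core edge and \<open>spoke_win\<close>.
\<close>

lemma two_spokes_win:
  assumes ind: "c \<in> {1..3}" "i \<in> {1..5}" "j \<in> {1..3}" "i' \<in> {1..5}" "j' \<in> {1..3}"
    and M: "w c i \<in> M" "w c i' \<in> M" and ne: "(i, j) \<noteq> (i', j')"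
    and e: "e \<in> edges G4" "e \<subseteq> {x c i j, x c i' j', a} \<union> M"
    and B: "zone c i j \<inter> B = {}" "zone c i' j' \<inter> B = {}" "a \<notin> B"
    and a: "a \<notin> zone c i j" "a \<notin> zone c i' j'"
  shows "maker_wins G4 M B"
proof (rule maker_wins.move[of "x c i j"])
  show "x c i j \<notin> B" using B(1) by (auto simp: zone_def)
  fix u
  show "maker_wins G4 (insert (x c i j) M) (insert u B)"
  proof (cases "u \<in> zone c i j")
    case False
    show ?thesis
    proof (rule spoke_win[OF ind(1-3)])
      show "insert (t c i j) (yz c i j) \<inter> insert u B = {}"
        using B(1) False by (simp add: zone_def)
    qed (use M in simp_all)
  next
    case True
    have u: "u \<notin> zone c i' j'" "u \<noteq> a"
      using True ne a by (auto simp: zone_def yz_def)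
    \<comment> \<open>The forced block at \<open>a\<close> lies outside the second zone, so
      \<open>spoke_win\<close> still applies there.\<close>
    show ?thesis
    proof (rule maker_wins_force[of "x c i' j'" _ e G4 a])
      show "x c i' j' \<notin> insert u B"
        using B(2) u by (auto simp: zone_def)
      show "maker_wins G4 (insert (x c i' j') (insert (x c i j) M)) (insert a (insert u B))"
      proof (rule spoke_win[OF ind(1,4,5)])
        show "insert (t c i' j') (yz c i' j') \<inter> insert a (insert u B) = {}"
          using B(2) a(2) u(1) by (simp add: zone_def)
      qed (use M in simp_all)
      show "e \<in> edges G4" by (rule e(1))
      show "e \<subseteq> insert a (insert (x c i' j') (insert (x c i j) M))" using e(2) by blast
      show "a \<notin> insert u B" using B(3) u(2) by simp
    qed
  qed
qed

text \<open>The group of the vertex in slot \<open>j\<close> of core edge \<open>k\<close>. The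
  shifts are 0, 2, 3, so in slots 2 and 3 the shift equals the slot.\<close>

definition grp :: "nat \<Rightarrow> nat \<Rightarrow> nat" where
  "grp k j = (if j = 1 then k else mod5 (k + j))"

definition core_zone :: "nat \<Rightarrow> nat \<Rightarrow> g4_vertex set" where
  "core_zone c k = (\<Union>j\<in>{1..3}. zone c (grp k j) j)"

lemma grp_range: "k \<in> {1..5} \<Longrightarrow> grp k j \<in> {1..5}"
  using mod5_range by (simp add: grp_def)

lemma grp_inj:
  assumes "grp k j = grp k' j" "j \<in> {1..3}" "k \<in> {1..5}" "k' \<in> {1..5}"
  shows "k = k'"
proof -
  have "j \<in> {1, 2, 3}" "k \<in> {1, 2, 3, 4, 5}" "k' \<in> {1, 2, 3, 4, 5}"
    using assms(2-4) by auto
  then show ?thesis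
    using assms(1) by (elim insertE emptyE; simp add: grp_def mod5_def)
qed

lemma zone_disjoint: "v \<in> zone c i j \<Longrightarrow> v \<in> zone c i' j' \<Longrightarrow> i = i' \<and> j = j'"
  by (auto simp: zone_def yz_def)

text \<open>A zone vertex determines its gadget, and in a fixed slot \<open>grp\<close> is a cyclic
  shift of \<open>k\<close>. One reply therefore damages at most one core edge.\<close>

lemma core_zone_disjoint:
  assumes "v \<in> core_zone c k" "v \<in> core_zone c k'" "k \<in> {1..5}" "k' \<in> {1..5}"
  shows "k = k'"
proof -
  obtain j j' where *: "j \<in> {1..3}" "v \<in> zone c (grp k j) j" "v \<in> zone c (grp k' j') j'"
    using assms(1,2) by (auto simp: core_zone_def)
  then have "grp k j = grp k' j" using zone_disjoint by blast
  then show ?thesis using grp_inj *(1) assms(3,4) by blast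
qed

lemma w_notin_core_zone: "w c i \<notin> core_zone c k"
  by (auto simp: core_zone_def zone_def yz_def)

lemma core_zone_subset: "core_zone c k \<subseteq> range (Copy c)"
  by (auto simp: core_zone_def zone_def yz_def)

lemma core_edge_G4:
  assumes "c \<in> {1..3}" "k \<in> {1..5}"
  shows "insert (if k \<in> {1, 2} then V c else S c) ((\<lambda>j. x c (grp k j) j) ` {1..3}) \<in> edges G4"
proof -
  have "{1..3::nat} = {1, 2, 3}" by auto
  then have eq: "(\<lambda>j. x c (grp k j) j) ` {1..3} = Copy c ` core_edge' k"
    by (simp add: core_edge'_def core_edge_def grp_def)
  have "k \<in> {1, 2} \<or> k \<in> {3, 4, 5}" using assms(2) by auto
  then show ?thesis
  proof
    assume k: "k \<in> {1, 2}"
    then have "insert (V c) (Copy c ` core_edge' k) \<in> edges G4"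
      unfolding G4_def hypergraph.select_convs using assms(1) by blast
    then show ?thesis using k by (simp only: eq if_True)
  next
    assume k: "k \<in> {3, 4, 5}"
    then have "insert (S c) (Copy c ` core_edge' k) \<in> edges G4"
      unfolding G4_def hypergraph.select_convs using assms(1) by blast
    moreover have "k \<notin> {1, 2}" using k by auto
    ultimately show ?thesis by (simp only: eq if_False)
  qed
qed

text \<open>The slots of \<open>i\<close> and \<open>i'\<close> are played as in
  \<open>two_spokes_win\<close>, with the third slot as the vertex \<open>a\<close>; the fourth
  vertex of the edge is \<open>V c\<close> or \<open>S c\<close>, and Maker owns both.\<close>

lemma core_win:
  assumes c: "c \<in> {1..3}" and k: "k \<in> {1..5}" and M: "V c \<in> M" "S c \<in> M"
    and i: "i \<in> grp k ` {1..3}" "w c i \<in> M" and i': "i' \<in> grp k ` {1..3}" "w c i' \<in> M"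
    and ne: "i \<noteq> i'" and B: "core_zone c k \<inter> B = {}"
  shows "maker_wins G4 M B"
proof -
  obtain j j' where j: "j \<in> {1..3}" "i = grp k j" "j' \<in> {1..3}" "i' = grp k j'"
    using i(1) i'(1) by blast
  with ne have "j \<noteq> j'" by blast
  \<comment> \<open>The remaining slot, as 1 + 2 + 3 = 6.\<close>
  define l where "l = 6 - j - j'"
  have l: "l \<in> {1..3}" "l \<noteq> j" "l \<noteq> j'" "{1..3} = {j, j', l}"
  proof -
    have three: "{1..3::nat} = {1, 2, 3}" by auto
    have "l \<in> {1..3} \<and> l \<noteq> j \<and> l \<noteq> j' \<and> {1..3} = {j, j', l}"
      using j(1,3) \<open>j \<noteq> j'\<close> unfolding three
      by (elim insertE emptyE; simp add: l_def insert_commute)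
    then show "l \<in> {1..3}" "l \<noteq> j" "l \<noteq> j'" "{1..3} = {j, j', l}" by simp_all
  qed
  have sub: "zone c (grp k m) m \<inter> B = {}" if "m \<in> {1..3}" for m
    using B that unfolding core_zone_def by blast
  show ?thesis
  proof (rule two_spokes_win[OF c _ j(1) _ j(3) i(2) i'(2) _ core_edge_G4[OF c k]])
    show "i \<in> {1..5}" "i' \<in> {1..5}" using j(2,4) grp_range[OF k] by simp_all
    show "(i, j) \<noteq> (i', j')" using ne by simp
    show "insert (if k \<in> {1, 2} then V c else S c) ((\<lambda>j. x c (grp k j) j) ` {1..3})
        \<subseteq> {x c i j, x c i' j', x c (grp k l) l} \<union> M"
      unfolding l(4) j(2,4) using M by simp
    show "zone c i j \<inter> B = {}" "zone c i' j' \<inter> B = {}"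
      using sub j by simp_all
    show "x c (grp k l) l \<notin> B"
      using sub[OF l(1)] by (auto simp: zone_def)
    show "x c (grp k l) l \<notin> zone c i j" "x c (grp k l) l \<notin> zone c i' j'"
      using l(2,3) by (auto simp: zone_def yz_def)
  qed
qed

text \<open>The two core zones are disjoint, so \<open>u\<close> spoils at most one and
  \<open>core_win\<close> applies to the other.\<close>

lemma core_fork:
  assumes "c \<in> {1..3}" "V c \<in> M" "S c \<in> M" "k \<in> {1..5}" "l \<in> {1..5}" "k \<noteq> l"
    and "i \<in> grp k ` {1..3}" "i' \<in> grp k ` {1..3}" "i \<noteq> i'" "w c i \<in> M" "w c i' \<in> M"
    and "h \<in> grp l ` {1..3}" "h' \<in> grp l ` {1..3}" "h \<noteq> h'" "w c h \<in> M" "w c h' \<in> M"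
    and "core_zone c k \<inter> B = {}" "core_zone c l \<inter> B = {}"
  shows "maker_wins G4 M (insert u B)"
proof (cases "u \<in> core_zone c k")
  case True
  then have "u \<notin> core_zone c l"
    using core_zone_disjoint assms(4-6) by blast
  then show ?thesis
    using assms by (intro core_win[of c l M h h']) simp_all
next
  case False
  then show ?thesis
    using assms by (intro core_win[of c k M i i']) simp_all
qed

section \<open>Maker's strategy\<close>

text \<open>A finite check. The two inverse shifts serve to choose \<open>a\<close> in
  \<open>rotate_away\<close>; the rows list the groups on the core edges that survive there.\<close>

lemma mod5_rotation:
  assumes "a \<in> {1..5}"
  defines "a\<^sub>1 \<equiv> mod5 (a + 1)" and "a\<^sub>2 \<equiv> mod5 (a + 2)"
    and "a\<^sub>3 \<equiv> mod5 (a + 3)" and "a\<^sub>4 \<equiv> mod5 (a + 4)"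
  shows "distinct [a, a\<^sub>1, a\<^sub>2, a\<^sub>3, a\<^sub>4]" "mod5 (a\<^sub>1 + 4) = a" "mod5 (a\<^sub>4 + 1) = a"
    and "grp a ` {1..3} = {a, a\<^sub>2, a\<^sub>3}"
    and "grp a\<^sub>2 ` {1..3} = {a\<^sub>2, a\<^sub>4, a}"
    and "grp a\<^sub>3 ` {1..3} = {a\<^sub>3, a, a\<^sub>1}"
    and "grp a\<^sub>4 ` {1..3} = {a\<^sub>4, a\<^sub>1, a\<^sub>2}"
proof -
  have three: "{1..3::nat} = {1, 2, 3}" by auto
  have "a \<in> {1, 2, 3, 4, 5}" using assms(1) by auto
  then have "distinct [a, a\<^sub>1, a\<^sub>2, a\<^sub>3, a\<^sub>4] \<and> mod5 (a\<^sub>1 + 4) = a \<and> mod5 (a\<^sub>4 + 1) = a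
    \<and> grp a ` {1..3} = {a, a\<^sub>2, a\<^sub>3} \<and> grp a\<^sub>2 ` {1..3} = {a\<^sub>2, a\<^sub>4, a}
    \<and> grp a\<^sub>3 ` {1..3} = {a\<^sub>3, a, a\<^sub>1} \<and> grp a\<^sub>4 ` {1..3} = {a\<^sub>4, a\<^sub>1, a\<^sub>2}"
    unfolding three a\<^sub>1_def a\<^sub>2_def a\<^sub>3_def a\<^sub>4_def
    by (elim insertE emptyE; simp add: mod5_def grp_def insert_commute del: One_nat_def; simp)
  then show "distinct [a, a\<^sub>1, a\<^sub>2, a\<^sub>3, a\<^sub>4]" "mod5 (a\<^sub>1 + 4) = a" "mod5 (a\<^sub>4 + 1) = a"
    "grp a ` {1..3} = {a, a\<^sub>2, a\<^sub>3}" "grp a\<^sub>2 ` {1..3} = {a\<^sub>2, a\<^sub>4, a}"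
    "grp a\<^sub>3 ` {1..3} = {a\<^sub>3, a, a\<^sub>1}" "grp a\<^sub>4 ` {1..3} = {a\<^sub>4, a\<^sub>1, a\<^sub>2}"
    by - (elim conjE, assumption)+
qed

text \<open>
  Up to rotation Breaker's first vertex \<open>u\<close> only touches \<open>w c a\<^sub>4\<close> or the zone of core edge
  \<open>a\<^sub>1\<close>, neither of which Maker needs.
\<close>

lemma rotate_away:
  obtains a where "a \<in> {1..5}" "u \<notin> {w c a, w c (mod5 (a + 1)), w c (mod5 (a + 2)), w c (mod5 (a + 3))}"
    "\<And>k. k \<in> {1..5} \<Longrightarrow> k \<noteq> mod5 (a + 1) \<Longrightarrow> u \<notin> core_zone c k"
proof -
  consider g where "g \<in> {1..5}" "u = w c g" | k where "k \<in> {1..5}" "u \<in> core_zone c k"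
    | "u \<notin> w c ` {1..5}" "\<forall>k\<in>{1..5}. u \<notin> core_zone c k"
    by blast
  then show thesis
  proof cases
    case 1
    \<comment> \<open>Chosen so that the lost group \<open>g\<close> becomes
      \<open>a\<^sub>4\<close>.\<close>
    define a where "a = mod5 (g + 1)"
    have a: "a \<in> {1..5}" by (simp only: a_def mod5_range)
    have "mod5 (a + 4) = g" using mod5_rotation(2)[OF 1(1)] by (simp add: a_def)
    with 1(2) have u: "u = w c (mod5 (a + 4))" by simp
    have "mod5 (a + 4) \<notin> {a, mod5 (a + 1), mod5 (a + 2), mod5 (a + 3)}"
      using mod5_rotation(1)[OF a] by auto
    then have "u \<notin> {w c a, w c (mod5 (a + 1)), w c (mod5 (a + 2)), w c (mod5 (a + 3))}"
      unfolding u by simp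
    then show thesis by (rule that[OF a]) (simp add: 1(2) w_notin_core_zone)
  next
    case 2
    \<comment> \<open>This is \<open>k - 1\<close> modulo 5, so that the damaged core edge
      \<open>k\<close> becomes \<open>a\<^sub>1\<close>.\<close>
    define a where "a = mod5 (k + 4)"
    have a: "a \<in> {1..5}" by (simp only: a_def mod5_range)
    have k: "mod5 (a + 1) = k" using mod5_rotation(3)[OF 2(1)] by (simp add: a_def)
    have "u \<notin> {w c a, w c (mod5 (a + 1)), w c (mod5 (a + 2)), w c (mod5 (a + 3))}"
      using 2(2) w_notin_core_zone by blast
    then show thesis
    proof (rule that[OF a])
      show "u \<notin> core_zone c l" if "l \<in> {1..5}" "l \<noteq> mod5 (a + 1)" for l
        using core_zone_disjoint[of u c l k] 2 that unfolding k by blast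
    qed
  next
    case 3
    have one: "(1::nat) \<in> {1..5}" by simp
    have "u \<notin> {w c 1, w c (mod5 (1 + 1)), w c (mod5 (1 + 2)), w c (mod5 (1 + 3))}"
      using 3(1) one mod5_range by blast
    then show thesis using 3(2) by (intro that[OF one]) blast+
  qed
qed

text \<open>\<open>u\<close> stands for the reply to the move that gave Maker the second of
  \<open>V c\<close> and \<open>S c\<close>.\<close>

lemma copy_win:
  assumes c: "c \<in> {1..3}" and M: "V c \<in> M" "S c \<in> M" and B: "range (Copy c) \<inter> B = {}"
  shows "maker_wins G4 M (insert u B)"
proof -
  obtain a where a: "a \<in> {1..5}"
    and uw: "u \<notin> {w c a, w c (mod5 (a + 1)), w c (mod5 (a + 2)), w c (mod5 (a + 3))}"
    and uz: "\<And>k. k \<in> {1..5} \<Longrightarrow> k \<noteq> mod5 (a + 1) \<Longrightarrow> u \<notin> core_zone c k"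
    using rotate_away[of u c] by blast
  define a\<^sub>1 a\<^sub>2 a\<^sub>3 a\<^sub>4 where a_defs: "a\<^sub>1 = mod5 (a + 1)" "a\<^sub>2 = mod5 (a + 2)"
    "a\<^sub>3 = mod5 (a + 3)" "a\<^sub>4 = mod5 (a + 4)"
  note rot = mod5_rotation[OF a, folded a_defs]
  note uw = uw[folded a_defs] and uz = uz[folded a_defs]
  have dist: "a \<noteq> a\<^sub>1" "a \<noteq> a\<^sub>2" "a \<noteq> a\<^sub>3" "a \<noteq> a\<^sub>4" "a\<^sub>1 \<noteq> a\<^sub>2" "a\<^sub>1 \<noteq> a\<^sub>3" "a\<^sub>1 \<noteq> a\<^sub>4"
    "a\<^sub>2 \<noteq> a\<^sub>3" "a\<^sub>2 \<noteq> a\<^sub>4" "a\<^sub>3 \<noteq> a\<^sub>4"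
    using rot(1) by auto
  have range: "a\<^sub>1 \<in> {1..5}" "a\<^sub>2 \<in> {1..5}" "a\<^sub>3 \<in> {1..5}" "a\<^sub>4 \<in> {1..5}"
    by (simp_all only: a_defs mod5_range)
  have wB: "w c i \<notin> B" for i using B by blast
  have zB: "core_zone c k \<inter> insert u B = {}" if "k \<in> {1..5}" "k \<noteq> a\<^sub>1" for k
    using B core_zone_subset uz that by blast
  have wu: "w c a \<notin> insert u B" "w c a\<^sub>1 \<notin> insert u B" "w c a\<^sub>2 \<notin> insert u B" "w c a\<^sub>3 \<notin> insert u B"
    using wB uw by auto
  have z: "core_zone c a \<inter> insert u B = {}" "core_zone c a\<^sub>2 \<inter> insert u B = {}"
    "core_zone c a\<^sub>3 \<inter> insert u B = {}" "core_zone c a\<^sub>4 \<inter> insert u B = {}"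
    using zB a range dist by metis+
  text \<open>
    Only a reply in the zone of core edge \<open>a\<close> stops both \<open>a\<^sub>2\<close> and \<open>a\<^sub>3\<close>.  Then \<open>a\<^sub>2\<close> still forces a
    reply in the zone of core edge \<open>a\<^sub>2\<close>, and \<open>a\<^sub>1\<close> threatens core edges \<open>a\<^sub>3\<close> and \<open>a\<^sub>4\<close>.
  \<close>
  show ?thesis
  proof (rule maker_wins.move[OF wu(1)])
    fix u\<^sub>2
    \<comment> \<open>Groups \<open>a\<close> and \<open>a\<^sub>2\<close> share core edges
      \<open>a\<close> and \<open>a\<^sub>2\<close>, groups \<open>a\<close> and
      \<open>a\<^sub>3\<close> share \<open>a\<close> and \<open>a\<^sub>3\<close>:
      \<open>w c a\<close> prepares two forks, and the first two cases leave one of them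
      intact.\<close>
    consider "u\<^sub>2 \<notin> insert (w c a\<^sub>2) (core_zone c a \<union> core_zone c a\<^sub>2)"
      | "u\<^sub>2 \<notin> insert (w c a\<^sub>3) (core_zone c a \<union> core_zone c a\<^sub>3)"
      | "u\<^sub>2 \<in> core_zone c a"
      using core_zone_disjoint[of u\<^sub>2 c a\<^sub>2 a\<^sub>3] w_notin_core_zone[of c a\<^sub>2] w_notin_core_zone[of c a\<^sub>3]
        range dist(8) by blast
    then show "maker_wins G4 (insert (w c a) M) (insert u\<^sub>2 (insert u B))"
    proof cases
      case 1
      show ?thesis
      proof (rule maker_wins.move[of "w c a\<^sub>2"])
        show "w c a\<^sub>2 \<notin> insert u\<^sub>2 (insert u B)" using 1 wu by auto
        show "maker_wins G4 (insert (w c a\<^sub>2) (insert (w c a) M))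
            (insert v (insert u\<^sub>2 (insert u B)))" for v
          by (rule core_fork[OF c _ _ a range(2), where i = a and i' = a\<^sub>2 and h = a and h' = a\<^sub>2])
            (use 1 M z dist in \<open>simp_all add: rot del: One_nat_def\<close>)
      qed
    next
      case 2
      show ?thesis
      proof (rule maker_wins.move[of "w c a\<^sub>3"])
        show "w c a\<^sub>3 \<notin> insert u\<^sub>2 (insert u B)" using 2 wu by auto
        show "maker_wins G4 (insert (w c a\<^sub>3) (insert (w c a) M))
            (insert v (insert u\<^sub>2 (insert u B)))" for v
          by (rule core_fork[OF c _ _ a range(3), where i = a and i' = a\<^sub>3 and h = a and h' = a\<^sub>3])
            (use 2 M z dist in \<open>simp_all add: rot del: One_nat_def\<close>)
      qed
    next
      case 3
      have u\<^sub>2: "u\<^sub>2 \<notin> core_zone c k" if "k \<in> {1..5}" "k \<noteq> a" for k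
        using core_zone_disjoint 3 a that by blast
      have w\<^sub>2: "u\<^sub>2 \<noteq> w c i" for i using 3 w_notin_core_zone by blast
      show ?thesis
      proof (rule maker_wins.move[of "w c a\<^sub>2"])
        show "w c a\<^sub>2 \<notin> insert u\<^sub>2 (insert u B)" using w\<^sub>2[of a\<^sub>2] wu by auto
        fix v
        show "maker_wins G4 (insert (w c a\<^sub>2) (insert (w c a) M)) (insert v (insert u\<^sub>2 (insert u B)))"
        proof (cases "v \<in> core_zone c a\<^sub>2")
          case False
          show ?thesis
            by (rule core_win[OF c range(2), where i = a and i' = a\<^sub>2])
              (use False M z dist u\<^sub>2[OF range(2)] in \<open>simp_all add: rot del: One_nat_def\<close>)
        next
          case True
          have v: "v \<notin> core_zone c k" if "k \<in> {1..5}" "k \<noteq> a\<^sub>2" for k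
            using core_zone_disjoint True range(2) that by blast
          have wv: "v \<noteq> w c i" for i using True w_notin_core_zone by blast
          \<comment> \<open>Core edge \<open>a\<^sub>3\<close> meets groups \<open>a\<close> and
            \<open>a\<^sub>1\<close>, core edge \<open>a\<^sub>4\<close> meets
            \<open>a\<^sub>1\<close> and \<open>a\<^sub>2\<close>; \<open>u\<close>,
            \<open>u\<^sub>2\<close> and \<open>v\<close> all miss these two zones.\<close>
          show ?thesis
          proof (rule maker_wins.move[of "w c a\<^sub>1"])
            show "w c a\<^sub>1 \<notin> insert v (insert u\<^sub>2 (insert u B))"
              using w\<^sub>2[of a\<^sub>1] wv[of a\<^sub>1] wu by auto
            show "maker_wins G4 (insert (w c a\<^sub>1) (insert (w c a\<^sub>2) (insert (w c a) M)))
                (insert v' (insert v (insert u\<^sub>2 (insert u B))))" for v'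
              by (rule core_fork[OF c _ _ range(3,4),
                    where i = a and i' = a\<^sub>1 and h = a\<^sub>1 and h' = a\<^sub>2])
                (use M z dist u\<^sub>2[OF range(3)] u\<^sub>2[OF range(4)] v[OF range(3)] v[OF range(4)]
                  in \<open>simp_all add: rot del: One_nat_def\<close>)
          qed
        qed
      qed
    qed
  qed
qed

lemma G4_win: "maker_wins G4 {} {}"
proof (rule maker_wins.move[of "V 1"])
  fix u\<^sub>1
  show "maker_wins G4 {V 1} {u\<^sub>1}"
  proof (cases "u\<^sub>1 \<in> insert (S 1) (range (Copy 1))")
    case False
    show ?thesis
    proof (rule maker_wins.move[of "S 1"])
      show "S 1 \<notin> {u\<^sub>1}" using False by blast
      show "maker_wins G4 {S 1, V 1} {v, u\<^sub>1}" for v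
        by (rule copy_win[of 1]) (use False in auto)
    qed
  next
    case u\<^sub>1: True
    show ?thesis
    proof (rule maker_wins.move[of "V 2"])
      show "V 2 \<notin> {u\<^sub>1}" using u\<^sub>1 by auto
      fix u\<^sub>2
      show "maker_wins G4 {V 2, V 1} {u\<^sub>2, u\<^sub>1}"
      proof (cases "u\<^sub>2 \<in> insert (S 2) (range (Copy 2))")
        case False
        show ?thesis
        proof (rule maker_wins.move[of "S 2"])
          show "S 2 \<notin> {u\<^sub>2, u\<^sub>1}" using False u\<^sub>1 by auto
          show "maker_wins G4 {S 2, V 2, V 1} {v, u\<^sub>2, u\<^sub>1}" for v
            by (rule copy_win[of 2]) (use False u\<^sub>1 in auto)
        qed
      next
        case u\<^sub>2: True
        \<comment> \<open>Both replies were spent on the first two copies or on \<open>S 1\<close>,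
          \<open>S 2\<close>.\<close>
        have free: "V i \<notin> {u\<^sub>2, u\<^sub>1}" "S 3 \<notin> {u\<^sub>2, u\<^sub>1}" "range (Copy 3) \<inter> {u\<^sub>2, u\<^sub>1} = {}" for i
          using u\<^sub>1 u\<^sub>2 by auto
        \<comment> \<open>The forced reply \<open>V 4\<close> lies outside copy 3, so Maker keeps
          the move there and takes \<open>S 3\<close>.\<close>
        show ?thesis
        proof (rule maker_wins_force[of "V 3" _ "{V 1, V 2, V 3, V 4}" _ "V 4"])
          show "{V 1, V 2, V 3, V 4} \<in> edges G4"
            unfolding G4_def hypergraph.select_convs by blast
          show "maker_wins G4 {V 3, V 2, V 1} {V 4, u\<^sub>2, u\<^sub>1}"
          proof (rule maker_wins.move[of "S 3"])
            show "S 3 \<notin> {V 4, u\<^sub>2, u\<^sub>1}" using free(2) by simp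
            show "maker_wins G4 {S 3, V 3, V 2, V 1} {v, V 4, u\<^sub>2, u\<^sub>1}" for v
              by (rule copy_win[of 3]) (use free(3) in auto)
          qed
        qed (use free(1) in auto)
      qed
    qed
  qed
qed simp

theorem proposition10:
  shows "\<exists>\<sigma>. maker_winning_strategy G4 \<sigma>"
  using wf_G4 G4_win by (rule maker_wins_imp_strategy)

end
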